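(* For every $n\ge0$, let $\Theta:=\rho^{-1}\circ\phi\colon\mathrm{UPF}_n\to\mathrm{Cay}_n$. Then $\Theta$ restricts to a bijection $\mathrm{DUPF}_n\to\mathrm{DCP}_n$. In particular, $|\mathrm{DCP}_n|=\widetilde F_n$.
   Context: $[n]=\{1,\dots,n\}$. $\widetilde F_n=\sum_{k=0}^n d_kS(n,k)$ is the deranged Bell number, where $S(n,k)$ is the Stirling number of the second kind and $d_k$ the number of derangements of $[k]$. A tuple $\alpha=(a_1,\dots,a_n)\in[n]^n$ is a parking function if, when cars $1,\dots,n$ enter in this order a one-way street with spots $1,\dots,n$ and car $i$ parks in the first free spot $s_i\ge a_i$, all cars manage to park. $\mathrm{UPF}_n$ (unit-interval parking functions) is the set of parking functions of length $n$ with $s_i-a_i\in\{0,1\}$ for all $i$; $\mathrm{UPF}_0$ consists of the empty tuple. Block structure: for $\alpha\in\mathrm{UPF}_n$ let $(a^\uparrow_1,\dots,a^\uparrow_n)$ be its weakly increasing rearrangement, let $\nu_1<\dots<\nu_m$ be the indices $i$ with $a^\uparrow_i=i$, and put $\nu_{m+1}=n+1$. The car set of block $j$ is $I_j=\{i\in[n]:\nu_j\le a_i<\nu_{j+1}\}$. Set $\phi(\alpha)=(I_1,\dots,I_m)\in\mathrm{OSP}_n$, where $\mathrm{OSP}_n$ is the set of ordered set partitions of $[n]$ (sequences of nonempty disjoint blocks with union $[n]$). $(C_1,\dots,C_k)\in\mathrm{OSP}_n$, whose blocks listed by increasing minimum element are $B_1,\dots,B_k$, is deranged if $C_i\ne B_i$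 for all $i\in[k]$ (the empty ordered set partition is deranged). $\mathrm{DUPF}_n$ is the set of $\alpha\in\mathrm{UPF}_n$ such that $\phi(\alpha)$ is deranged. A Cayley permutation of length $n$ is a sequence $p=(p_1,\dots,p_n)$ of positive integers whose set of values is $\{1,\dots,k\}$ for some $k$; $\mathrm{Cay}_n$ is the set of these. The bijection $\rho\colon\mathrm{Cay}_n\to\mathrm{OSP}_n$ is $\rho(p)=(C_1,\dots,C_k)$ with $C_v=\{i\in[n]:p_i=v\}$. For $p\in\mathrm{Cay}_n$ with values $\{1,\dots,k\}$ let $m_v=\min\{i:p_i=v\}$, and let $\theta_p\in S_k$ be the permutation such that $\theta_p(v)$ is the rank of $m_v$ among $m_1,\dots,m_k$ sorted increasingly (so $v$ is the $\theta_p(v)$-th distinct value to appear in $p$). $\mathrm{DCP}_n$ (deranged Cayley permutations) is the set of $p\in\mathrm{Cay}_n$ for which $\theta_p$ is a derangement. *)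

theory Defs
  imports "HOL-Combinatorics.Stirling" "HOL-Combinatorics.Permutations"
begin

text \<open>
  Cars, spots, values and blocks are numbered from 1, whereas list positions start
  at 0: the entry \<open>a\<^sub>i\<close> of a tuple is \<open>\<alpha> ! (i - 1)\<close>.
\<close>

definition derangements :: "nat \<Rightarrow> (nat \<Rightarrow> nat) set" where
  "derangements k = {\<pi>. \<pi> permutes {1..k} \<and> (\<forall>i\<in>{1..k}. \<pi> i \<noteq> i)}"

definition deranged_bell :: "nat \<Rightarrow> nat" where
  "deranged_bell n = (\<Sum>k=0..n. card (derangements k) * Stirling n k)"


section \<open>Unit interval parking functions\<close>

text \<open>
  \<open>park n occ \<alpha>\<close> is the list of spots taken by the cars with preferences \<open>\<alpha>\<close> on a street with
  spots \<open>1, \<dots>, n\<close> of which those in \<open>occ\<close> are already occupied; it is \<open>None\<close> if some car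
  cannot park.
\<close>

fun park :: "nat \<Rightarrow> nat set \<Rightarrow> nat list \<Rightarrow> nat list option" where
  "park n occ [] = Some []"
| "park n occ (a # as) =
     (if {a..n} - occ = {} then None
      else let s = Min ({a..n} - occ) in map_option (Cons s) (park n (insert s occ) as))"

definition parking_functions :: "nat \<Rightarrow> nat list set" where
  "parking_functions n = {\<alpha>. length \<alpha> = n \<and> set \<alpha> \<subseteq> {1..n} \<and> park n {} \<alpha> \<noteq> None}"

definition UPF :: "nat \<Rightarrow> nat list set" where
  "UPF n = {\<alpha> \<in> parking_functions n.
     \<forall>i\<in>{1..n}. int (the (park n {} \<alpha>) ! (i - 1)) - int (\<alpha> ! (i - 1)) \<in> {0, 1}}"


section \<open>Ordered set partitions\<close>

definition OSP :: "nat \<Rightarrow> nat set list set" where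
  "OSP n = {Cs. (\<forall>C\<in>set Cs. C \<noteq> {}) \<and>
     (\<forall>i j. i < j \<and> j < length Cs \<longrightarrow> Cs ! i \<inter> Cs ! j = {}) \<and> \<Union> (set Cs) = {1..n}}"

text \<open>\<open>sort_key Min Cs\<close> is \<open>B\<^sub>1, \<dots>, B\<^sub>k\<close>, the blocks listed by increasing minimum.\<close>

definition deranged_OSP :: "nat \<Rightarrow> nat set list set" where
  "deranged_OSP n = {Cs \<in> OSP n. \<forall>i<length Cs. Cs ! i \<noteq> sort_key Min Cs ! i}"


section \<open>Block structure of unit interval parking functions\<close>

definition block_starts :: "nat list \<Rightarrow> nat list" where
  "block_starts \<alpha> = sorted_list_of_set {i \<in> {1..length \<alpha>}. sort \<alpha> ! (i - 1) = i}"

definition phi :: "nat list \<Rightarrow> nat set list" where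
  "phi \<alpha> = (let \<nu> = block_starts \<alpha> @ [length \<alpha> + 1] in
     map (\<lambda>j. {i \<in> {1..length \<alpha>}. \<nu> ! j \<le> \<alpha> ! (i - 1) \<and> \<alpha> ! (i - 1) < \<nu> ! (j + 1)})
       [0..<length (block_starts \<alpha>)])"

definition DUPF :: "nat \<Rightarrow> nat list set" where
  "DUPF n = {\<alpha> \<in> UPF n. phi \<alpha> \<in> deranged_OSP n}"


section \<open>Cayley permutations\<close>

definition Cay :: "nat \<Rightarrow> nat list set" where
  "Cay n = {p. length p = n \<and> (\<exists>k. set p = {1..k})}"

text \<open>In the following definitions \<open>card (set p)\<close> is the \<open>k\<close> with \<open>set p = {1..k}\<close>.\<close>

definition rho :: "nat list \<Rightarrow> nat set list" where
  "rho p = map (\<lambda>v. {i \<in> {1..length p}. p ! (i - 1) = v}) [1..<card (set p) + 1]"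

definition first_occ :: "nat list \<Rightarrow> nat \<Rightarrow> nat" where
  "first_occ p v = Min {i \<in> {1..length p}. p ! (i - 1) = v}"

text \<open>Extended by the identity outside \<open>{1..k}\<close>, as required by \<open>permutes\<close>.\<close>

definition theta :: "nat list \<Rightarrow> nat \<Rightarrow> nat" where
  "theta p v = (if v \<in> {1..card (set p)}
     then card {w \<in> {1..card (set p)}. first_occ p w \<le> first_occ p v} else v)"

definition DCP :: "nat \<Rightarrow> nat list set" where
  "DCP n = {p \<in> Cay n. theta p \<in> derangements (card (set p))}"

text \<open>\<open>rho\<close> is a bijection from \<open>Cay n\<close> to \<open>OSP n\<close>, so \<open>inv_into\<close> is its genuine inverse there.\<close>

definition Theta :: "nat \<Rightarrow> nat list \<Rightarrow> nat list" where
  "Theta n = inv_into (Cay n) rho \<circ> phi"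

end

theory Submission
  imports Defs
begin

text \<open>
  In a unit interval parking function the car \<open>c\<close> in spot \<open>t\<close> either prefers \<open>t\<close>, or prefers \<open>t - 1\<close> and
  finds it taken, that is, the car in spot \<open>t - 1\<close> came before \<open>c\<close>. The blocks are therefore the
  maximal runs of spots whose first car alone is lucky, and cars increase along each run. So a
  Cayley permutation \<open>p\<close>, read as the list of block numbers of the cars, determines the parking
  function: car \<open>i\<close> parks in the spot given by the rank of \<open>(p\<^sub>i, i)\<close> in lexicographic order, and it is
  lucky iff \<open>p\<^sub>i\<close> has not occurred before. This inverts \<open>Theta\<close>.

  Let \<open>L\<close> list the values of \<open>p\<close> in order of first occurrence. Then \<open>L\<close> is the inverse of \<open>theta p\<close>, and
  the blocks of \<open>rho p\<close> sorted by minimum are the blocks numbered by \<open>L\<close>; hence both notions of being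
  deranged say that \<open>L\<close> has no fixed point. For a given \<open>L\<close> of length \<open>k\<close> there are \<open>S(n, k)\<close> such \<open>p\<close>,
  by the Stirling recurrence on the last entry.
\<close>

section \<open>Order of first occurrence\<close>

text \<open>\<open>remdups\<close> keeps the last copy of each element; the two reversals make it
  keep the first one.\<close>

definition occ_order :: "nat list \<Rightarrow> nat list" where
  "occ_order p = rev (remdups (rev p))"

lemma set_occ_order [simp]: "set (occ_order p) = set p"
  by (simp add: occ_order_def)

lemma distinct_occ_order [simp]: "distinct (occ_order p)"
  by (simp add: occ_order_def)

lemma length_occ_order [simp]: "length (occ_order p) = card (set p)"
  by (metis distinct_card distinct_occ_order set_occ_order)

lemma nth_occ_order_in: "j < card (set p) \<Longrightarrow> occ_order p ! j \<in> set p"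
  by (metis length_occ_order nth_mem set_occ_order)

lemma occ_order_obtain:
  assumes "v \<in> set p"
  obtains j where "j < card (set p)" "v = occ_order p ! j"
  using assms by (metis in_set_conv_nth length_occ_order set_occ_order)

lemma occ_order_snoc:
  "occ_order (p @ [x]) = (if x \<in> set p then occ_order p else occ_order p @ [x])"
  by (simp add: occ_order_def)

lemma first_occ_snoc:
  assumes "v \<in> set p"
  shows "first_occ (p @ [x]) v = first_occ p v"
proof -
  let ?A = "{i \<in> {1..length p}. p ! (i - 1) = v}"
  have ne: "?A \<noteq> {}"
  proof -
    obtain i where "i < length p" "p ! i = v"
      using assms by (auto simp: in_set_conv_nth)
    then have "Suc i \<in> ?A" by auto
    then show ?thesis by blast
  qed
  have "{i \<in> {1..length (p @ [x])}. (p @ [x]) ! (i - 1) = v} =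
      ?A \<union> (if x = v then {Suc (length p)} else {})" (is "?B = _")
    by (auto simp: nth_append le_Suc_eq)
  moreover have "Min ?A \<le> length p"
    using Min_in[OF _ ne] by auto
  ultimately show ?thesis
    unfolding first_occ_def using ne by auto
qed

lemma first_occ_in:
  assumes "v \<in> set p"
  shows "first_occ p v \<in> {1..length p}" "p ! (first_occ p v - 1) = v"
proof -
  let ?A = "{i \<in> {1..length p}. p ! (i - 1) = v}"
  obtain i where "i < length p" "p ! i = v"
    using assms by (auto simp: in_set_conv_nth)
  then have "Suc i \<in> ?A" by auto
  then have "Min ?A \<in> ?A" by (intro Min_in) auto
  then show "first_occ p v \<in> {1..length p}" "p ! (first_occ p v - 1) = v"
    unfolding first_occ_def by auto
qed

text \<open>Appending an entry leaves the earlier first occurrences where they are, and a new value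
  first occurs at the very end, after all of them.\<close>

lemma sorted_first_occ: "sorted_wrt (\<lambda>v w. first_occ p v < first_occ p w) (occ_order p)"
proof (induction p rule: rev_induct)
  case Nil
  then show ?case by (simp add: occ_order_def)
next
  case (snoc x p)
  have old: "sorted_wrt (\<lambda>v w. first_occ (p @ [x]) v < first_occ (p @ [x]) w) (occ_order p)"
    using snoc by (rule sorted_wrt_mono_rel[rotated]) (simp add: first_occ_snoc)
  have "first_occ (p @ [x]) v < first_occ (p @ [x]) x" if "x \<notin> set p" "v \<in> set p" for v
  proof -
    have "first_occ (p @ [x]) x = Suc (length p)"
      using first_occ_in[of x "p @ [x]"] that(1)
      by (auto simp: nth_append split: if_splits)
        (metis One_nat_def Suc_leI Suc_le_lessD Suc_pred leD le_antisym not_less_eq_eq nth_mem)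
    moreover have "first_occ (p @ [x]) v \<le> length p"
      using first_occ_in(1)[OF that(2)] first_occ_snoc[OF that(2)] by auto
    ultimately show ?thesis by simp
  qed
  then show ?case
    using old by (auto simp: occ_order_snoc sorted_wrt_append)
qed

text \<open>First occurrences increase strictly along \<open>occ_order p\<close>, so the values
  counted by \<open>theta\<close> are exactly the entries at positions \<open>0\<close> to
  \<open>j\<close>. Thus \<open>occ_order p\<close> is the one-line form of the inverse of
  \<open>theta p\<close>, with positions shifted by one.\<close>

lemma theta_occ_order:
  assumes "set p = {1..k}" "j < k"
  shows "theta p (occ_order p ! j) = Suc j"
proof -
  let ?L = "occ_order p"
  have card: "card (set p) = k" using assms(1) by simp
  have mem: "?L ! j \<in> {1..k}"
    using assms card by (metis nth_occ_order_in)
  have less: "first_occ p (?L ! a) < first_occ p (?L ! b)" if "a < b" "b < k" for a b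
    using sorted_first_occ[of p] that card by (auto simp: sorted_wrt_iff_nth_less)
  have iff: "first_occ p (?L ! a) \<le> first_occ p (?L ! j) \<longleftrightarrow> a \<le> j" if "a < k" for a
    using less[of a j] less[of j a] that assms(2) by (cases a j rule: linorder_cases) auto
  have "{w \<in> {1..k}. first_occ p w \<le> first_occ p (?L ! j)} = (!) ?L ` {..j}"
  proof (intro equalityI subsetI)
    fix w assume w: "w \<in> {w \<in> {1..k}. first_occ p w \<le> first_occ p (?L ! j)}"
    then have "w \<in> set p" using assms by simp
    then obtain a where "a < k" "w = ?L ! a"
      using card by (metis occ_order_obtain)
    then show "w \<in> (!) ?L ` {..j}" using w iff by auto
  next
    fix w assume "w \<in> (!) ?L ` {..j}"
    then obtain a where a: "a \<le> j" "w = ?L ! a" by auto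
    then have "w \<in> set p" using assms(2) card by (simp add: nth_occ_order_in)
    then show "w \<in> {w \<in> {1..k}. first_occ p w \<le> first_occ p (?L ! j)}"
      using a iff[of a] assms by auto
  qed
  moreover have "card ((!) ?L ` {..j}) = Suc j"
    using assms(2) card by (subst card_image) (auto simp: inj_on_def nth_eq_iff_index_eq)
  ultimately show ?thesis
    using mem card by (simp add: theta_def)
qed

lemma theta_permutes:
  assumes "set p = {1..k}"
  shows "theta p permutes {1..k}"
proof (rule bij_imp_permutes)
  have card: "card (set p) = k" using assms by simp
  have "{1..k} \<subseteq> theta p ` {1..k}"
  proof
    fix j assume "j \<in> {1..k}"
    then have "theta p (occ_order p ! (j - 1)) = j" "occ_order p ! (j - 1) \<in> set p"
      using theta_occ_order[OF assms, of "j - 1"] nth_occ_order_in[of "j - 1" p] card by auto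
    then show "j \<in> theta p ` {1..k}" using assms by force
  qed
  moreover have "theta p ` {1..k} \<subseteq> {1..k}"
  proof
    fix x assume "x \<in> theta p ` {1..k}"
    then obtain v where v: "v \<in> set p" "x = theta p v" using assms by auto
    then obtain j where "j < k" "v = occ_order p ! j"
      using card by (metis occ_order_obtain)
    then show "x \<in> {1..k}" using v theta_occ_order[OF assms] by auto
  qed
  ultimately have "theta p ` {1..k} = {1..k}" by blast
  then show "bij_betw (theta p) {1..k} {1..k}"
    by (simp add: bij_betw_def eq_card_imp_inj_on)
  show "theta p x = x" if "x \<notin> {1..k}" for x
    using that card by (auto simp: theta_def)
qed

definition deranged_list :: "nat list \<Rightarrow> bool" where
  "deranged_list L \<longleftrightarrow> (\<forall>j<length L. L ! j \<noteq> Suc j)"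

text \<open>A permutation and its inverse have the same fixed points; injectivity of
  \<open>theta p\<close> carries the condition over to the list.\<close>

lemma theta_derangement_iff:
  assumes "set p = {1..k}"
  shows "theta p \<in> derangements k \<longleftrightarrow> deranged_list (occ_order p)"
proof -
  have card: "card (set p) = k" using assms by simp
  have inj: "inj (theta p)" using theta_permutes[OF assms] by (rule permutes_inj)
  have "(\<forall>i\<in>{1..k}. theta p i \<noteq> i) \<longleftrightarrow> (\<forall>j<k. theta p (Suc j) \<noteq> Suc j)"
    by (metis Suc_le_eq Suc_pred atLeastAtMost_iff le_add1 plus_1_eq_Suc One_nat_def)
  also have "\<dots> \<longleftrightarrow> (\<forall>j<k. theta p (Suc j) \<noteq> theta p (occ_order p ! j))"
    using theta_occ_order[OF assms] by simp
  also have "\<dots> \<longleftrightarrow> (\<forall>j<k. occ_order p ! j \<noteq> Suc j)"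
    using inj by (metis injD)
  finally show ?thesis
    using theta_permutes[OF assms] card by (simp add: derangements_def deranged_list_def)
qed

lemma DCP_iff: "p \<in> DCP n \<longleftrightarrow> p \<in> Cay n \<and> deranged_list (occ_order p)"
  using theta_derangement_iff[of p] by (auto simp: DCP_def Cay_def)

section \<open>Counting deranged Cayley permutations\<close>

lemma finite_lists_remdups: "finite {q. length q = n \<and> remdups q = L}"
proof (rule finite_subset)
  show "{q. length q = n \<and> remdups q = L} \<subseteq> {q. set q \<subseteq> set L \<and> length q = n}"
    by auto
qed (simp add: finite_lists_length_eq)

text \<open>The head either recurs in the tail, leaving \<open>length L\<close> choices for it and
  the same \<open>L\<close> for the tail, or is new and then must be the head of \<open>L\<close>.
  This is the Stirling recurrence; for \<open>occ_order\<close> the head becomes the last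
  entry.\<close>

lemma card_lists_remdups:
  "distinct L \<Longrightarrow> card {q :: 'a list. length q = n \<and> remdups q = L} = Stirling n (length L)"
proof (induction n arbitrary: L)
  case 0
  have "{q :: 'a list. length q = 0 \<and> remdups q = L} = (if L = [] then {[]} else {})"
    by auto
  then show ?case by (cases L) auto
next
  case (Suc n)
  show ?case
  proof (cases L)
    case Nil
    then have "{q :: 'a list. length q = Suc n \<and> remdups q = L} = {}" by auto
    then show ?thesis using Nil by simp
  next
    case (Cons x M)
    let ?A = "\<lambda>L. {q :: 'a list. length q = n \<and> remdups q = L}"
    have set_eq: "set q = set L" if "remdups q = L" for q using that by auto
    have "{q. length q = Suc n \<and> remdups q = L} =
        Cons x ` ?A M \<union> (\<lambda>(y, q). y # q) ` (set L \<times> ?A L)" (is "_ = ?B \<union> ?C")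
    proof (intro equalityI subsetI)
      fix q assume "q \<in> {q. length q = Suc n \<and> remdups q = L}"
      then obtain y r where q: "q = y # r" "length r = n" "remdups q = L"
        by (cases q) auto
      show "q \<in> ?B \<union> ?C"
      proof (cases "y \<in> set r")
        case True
        then have "remdups r = L" using q by simp
        then show ?thesis using q True by auto
      next
        case False
        then have "y = x" "remdups r = M" using q Cons by auto
        then show ?thesis using q by auto
      qed
    next
      fix q assume "q \<in> ?B \<union> ?C"
      then consider r where "q = x # r" "length r = n" "remdups r = M"
        | y r where "q = y # r" "y \<in> set L" "length r = n" "remdups r = L"
        by auto
      then show "q \<in> {q. length q = Suc n \<and> remdups q = L}"
      proof cases
        case 1
        then show ?thesis using Suc.prems Cons by auto
      next
        case 2
        then show ?thesis using set_eq[of r] by simp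
      qed
    qed
    \<comment> \<open>A common word would have a tail whose \<open>remdups\<close> is both
      \<open>M\<close> and \<open>x # M\<close>.\<close>
    moreover have "?B \<inter> ?C = {}"
      using Suc.prems Cons by auto
    moreover have "card ?B = Stirling n (length M)"
      using Suc.IH[of M] Suc.prems Cons by (subst card_image) auto
    moreover have "card ?C = length L * Stirling n (length L)"
      using Suc.IH[of L] Suc.prems
      by (subst card_image) (auto simp: inj_on_def card_cartesian_product distinct_card)
    moreover have "finite ?B" "finite ?C" by (auto simp: finite_lists_remdups)
    ultimately show ?thesis
      using Cons by (simp add: card_Un_disjoint)
  qed
qed

lemma card_lists_occ_order:
  assumes "distinct L"
  shows "card {p. length p = n \<and> occ_order p = L} = Stirling n (length L)"
proof -
  have "{p. length p = n \<and> occ_order p = L} = rev ` {q. length q = n \<and> remdups q = rev L}"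
    by (auto simp: occ_order_def image_iff) (metis length_rev rev_rev_ident)
  then show ?thesis
    using assms card_lists_remdups[of "rev L" n] by (simp add: card_image)
qed

section \<open>Derangements in one-line notation and the sum over them\<close>

definition deranged_lists :: "nat \<Rightarrow> nat list set" where
  "deranged_lists k = {L. distinct L \<and> set L = {1..k} \<and> deranged_list L}"

lemma length_deranged_lists: "L \<in> deranged_lists k \<Longrightarrow> length L = k"
  by (auto simp: deranged_lists_def dest: distinct_card)

lemma finite_deranged_lists: "finite (deranged_lists k)"
proof (rule finite_subset)
  show "deranged_lists k \<subseteq> {L. set L \<subseteq> {1..k} \<and> length L = k}"
    using length_deranged_lists by (auto simp: deranged_lists_def)
qed (simp add: finite_lists_length_eq)

lemma card_deranged_lists: "card (deranged_lists k) = card (derangements k)"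
proof -
  let ?f = "\<lambda>\<pi>::nat \<Rightarrow> nat. map \<pi> [1..<Suc k]"
  have "bij_betw ?f (derangements k) (deranged_lists k)"
  proof (rule bij_betw_imageI)
    show "inj_on ?f (derangements k)"
    proof (rule inj_onI, rule ext)
      fix \<pi> \<sigma> x
      assume *: "\<pi> \<in> derangements k" "\<sigma> \<in> derangements k" "?f \<pi> = ?f \<sigma>"
      then have "\<pi> permutes {1..k}" "\<sigma> permutes {1..k}" "\<forall>x\<in>{1..k}. \<pi> x = \<sigma> x"
        by (auto simp: derangements_def)
      then show "\<pi> x = \<sigma> x" by (metis permutes_not_in)
    qed
    show "?f ` derangements k = deranged_lists k"
    proof (intro equalityI subsetI)
      fix L assume "L \<in> ?f ` derangements k"
      then obtain \<pi> where \<pi>: "\<pi> permutes {1..k}" "\<forall>i\<in>{1..k}. \<pi> i \<noteq> i" "L = ?f \<pi>"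
        by (auto simp: derangements_def)
      have "set L = \<pi> ` {1..k}" using \<pi>(3) by auto
      then have "set L = {1..k}" using permutes_image[OF \<pi>(1)] by simp
      moreover have "distinct L"
        using \<pi> by (auto simp: distinct_map intro: permutes_inj_on simp del: upt_Suc)
      moreover have "deranged_list L"
        using \<pi> by (auto simp: deranged_list_def simp del: upt_Suc)
      ultimately show "L \<in> deranged_lists k" by (simp add: deranged_lists_def)
    next
      fix L assume L: "L \<in> deranged_lists k"
      \<comment> \<open>The list is read as one-line notation; the identity outside
        \<open>{1..k}\<close> is what \<open>permutes\<close> demands.\<close>
      define \<pi> where "\<pi> = (\<lambda>i. if i \<in> {1..k} then L ! (i - 1) else i)"
      have len: "length L = k" using L by (rule length_deranged_lists)
      have eq: "?f \<pi> = L"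
        using len by (intro nth_equalityI) (auto simp: \<pi>_def simp del: upt_Suc)
      have "\<pi> ` {1..k} = set (?f \<pi>)" by (simp add: atLeastLessThanSuc_atLeastAtMost del: upt_Suc)
      then have "\<pi> ` {1..k} = {1..k}" using L unfolding eq by (simp add: deranged_lists_def)
      then have "\<pi> permutes {1..k}"
        by (intro bij_imp_permutes) (auto simp: bij_betw_def eq_card_imp_inj_on \<pi>_def)
      moreover have "\<forall>i\<in>{1..k}. \<pi> i \<noteq> i"
      proof
        fix i assume "i \<in> {1..k}"
        then show "\<pi> i \<noteq> i"
          using L len by (cases i) (auto simp: \<pi>_def deranged_lists_def deranged_list_def)
      qed
      ultimately show "L \<in> ?f ` derangements k"
        using eq by (intro image_eqI[of _ _ \<pi>]) (auto simp: derangements_def)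
    qed
  qed
  then show ?thesis using bij_betw_same_card by metis
qed

text \<open>Deranged Cayley permutations are sorted by their number \<open>k\<close> of values and
  then by their order of first occurrence, a deranged list; each such class has
  \<open>Stirling n k\<close> members.\<close>

lemma card_DCP: "card (DCP n) = deranged_bell n"
proof -
  let ?S = "\<lambda>k. \<Union>L\<in>deranged_lists k. {p. length p = n \<and> occ_order p = L}"
  \<comment> \<open>The index \<open>k\<close> can be read off from \<open>p\<close>, which makes
    the sets \<open>?S k\<close> disjoint.\<close>
  have length: "card (set p) = k" if "p \<in> ?S k" for p k
    using that length_deranged_lists length_occ_order by force
  have fin: "finite {p. length p = n \<and> occ_order p = L}" for L
    by (rule finite_subset[OF _ finite_lists_length_eq[of "set L" n]]) auto
  have "DCP n = (\<Union>k\<in>{0..n}. ?S k)"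
  proof (intro equalityI subsetI)
    fix p assume p: "p \<in> DCP n"
    then obtain k where k: "set p = {1..k}" "length p = n"
      by (auto simp: DCP_def Cay_def)
    then have "k \<le> n" using card_length[of p] by simp
    then show "p \<in> (\<Union>k\<in>{0..n}. ?S k)"
      using k p by (auto simp: DCP_iff deranged_lists_def)
  next
    fix p assume "p \<in> (\<Union>k\<in>{0..n}. ?S k)"
    then show "p \<in> DCP n" by (auto simp: DCP_iff Cay_def deranged_lists_def)
  qed
  also have "card \<dots> = (\<Sum>k\<in>{0..n}. card (?S k))"
  proof (rule card_UN_disjoint)
    show "\<forall>i\<in>{0..n}. \<forall>j\<in>{0..n}. i \<noteq> j \<longrightarrow> ?S i \<inter> ?S j = {}"
    proof (intro ballI impI)
      fix i j :: nat assume "i \<noteq> j"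
      have False if "p \<in> ?S i" "p \<in> ?S j" for p
        using length[OF that(1)] length[OF that(2)] \<open>i \<noteq> j\<close> by simp
      then show "?S i \<inter> ?S j = {}" by blast
    qed
    show "\<forall>k\<in>{0..n}. finite (?S k)"
      by (simp add: fin finite_deranged_lists)
  qed simp
  also have "\<dots> = (\<Sum>k=0..n. card (derangements k) * Stirling n k)"
  proof (rule sum.cong[OF refl])
    fix k
    have "card (?S k) = (\<Sum>L\<in>deranged_lists k. card {p. length p = n \<and> occ_order p = L})"
      by (rule card_UN_disjoint) (auto simp: fin finite_deranged_lists)
    also have "\<dots> = (\<Sum>L\<in>deranged_lists k. Stirling n k)"
      using length_deranged_lists
      by (intro sum.cong) (auto simp: card_lists_occ_order deranged_lists_def)
    finally show "card (?S k) = card (derangements k) * Stirling n k"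
      by (simp add: card_deranged_lists)
  qed
  finally show ?thesis by (simp add: deranged_bell_def)
qed

section \<open>Ordered set partitions of Cayley permutations\<close>

lemma length_rho [simp]: "length (rho p) = card (set p)"
  unfolding rho_def by (simp del: upt_Suc)

lemma nth_rho:
  "j < card (set p) \<Longrightarrow> rho p ! j = {i \<in> {1..length p}. p ! (i - 1) = Suc j}"
  by (simp add: rho_def del: upt_Suc)

lemma rho_nonempty:
  fixes p :: "nat list"
  assumes "v \<in> set p"
  shows "{i \<in> {1..length p}. p ! (i - 1) = v} \<noteq> {}"
  using first_occ_in[OF assms] by blast

lemma rho_OSP:
  assumes "p \<in> Cay n"
  shows "rho p \<in> OSP n"
proof -
  obtain k where k: "set p = {1..k}" "length p = n"
    using assms by (auto simp: Cay_def)
  have ne: "\<forall>C\<in>set (rho p). C \<noteq> {}"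
  proof
    fix C assume "C \<in> set (rho p)"
    then obtain j where j: "j < k" "C = rho p ! j" using k by (auto simp: in_set_conv_nth)
    then have "Suc j \<in> set p" using k by auto
    then show "C \<noteq> {}" using j k rho_nonempty[of "Suc j" p] by (simp add: nth_rho)
  qed
  have disj: "\<forall>i j. i < j \<and> j < length (rho p) \<longrightarrow> rho p ! i \<inter> rho p ! j = {}"
    by (auto simp: nth_rho)
  have "\<Union> (set (rho p)) = {1..n}"
  proof (intro equalityI subsetI)
    fix i assume i: "i \<in> {1..n}"
    then have "p ! (i - 1) \<in> set p" using k by (intro nth_mem) auto
    then show "i \<in> \<Union> (set (rho p))"
      using i k by (auto simp: rho_def simp del: upt_Suc)
  qed (use k in \<open>auto simp: in_set_conv_nth nth_rho\<close>)
  then show ?thesis using ne disj by (simp add: OSP_def)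
qed

text \<open>The entry of \<open>p\<close> at a position is the number of the block containing that
  position.\<close>

lemma inj_on_rho: "inj_on rho (Cay n)"
proof (rule inj_onI)
  fix p q assume p: "p \<in> Cay n" and q: "q \<in> Cay n" and eq: "rho p = rho q"
  obtain k where k: "set p = {1..k}" "length p = n" using p by (auto simp: Cay_def)
  have k': "length q = n" "card (set q) = k"
    using q k arg_cong[OF eq, of length] by (auto simp: Cay_def)
  show "p = q"
  proof (rule nth_equalityI)
    fix i assume i: "i < length p"
    then obtain j where j: "p ! i = Suc j" "j < k"
      using k nth_mem[OF i] by (cases "p ! i") auto
    then have "Suc i \<in> rho p ! j" using i k by (simp add: nth_rho)
    then have "Suc i \<in> rho q ! j" using eq by simp
    then show "p ! i = q ! i" using j k' by (simp add: nth_rho)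
  qed (use k k' in simp)
qed

text \<open>The minimum of block \<open>v\<close> is \<open>first_occ p v\<close>, which increases
  along \<open>occ_order p\<close>. Distinct blocks have distinct minima, so the sorted list is
  unique.\<close>

lemma sort_key_rho:
  assumes "p \<in> Cay n"
  shows "sort_key Min (rho p) =
    map (\<lambda>v. {i \<in> {1..length p}. p ! (i - 1) = v}) (occ_order p)" (is "_ = map ?C _")
proof -
  obtain k where k: "set p = {1..k}" using assms by (auto simp: Cay_def)
  have Min_C: "Min \<circ> ?C = first_occ p" by (auto simp: first_occ_def)
  have rho: "rho p = map ?C [1..<Suc k]" using k by (simp add: rho_def)
  have inj: "inj_on (first_occ p) (set p)"
    using first_occ_in(2) by (metis inj_onI)
  show ?thesis
  proof (rule sort_key_inj_key_eq)
    show "mset (rho p) = mset (map ?C (occ_order p))"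
    proof -
      have "mset [1..<Suc k] = mset (occ_order p)"
        by (subst set_eq_iff_mset_eq_distinct[symmetric])
          (simp_all add: k atLeastLessThanSuc_atLeastAtMost del: upt_Suc)
      then show ?thesis unfolding rho mset_map by (rule arg_cong)
    qed
    show "inj_on Min (set (rho p))"
    proof (rule inj_onI)
      fix A B assume AB: "A \<in> set (rho p)" "B \<in> set (rho p)" "Min A = Min B"
      have img: "set (rho p) = ?C ` set p"
        unfolding rho set_map set_upt k atLeastLessThanSuc_atLeastAtMost ..
      obtain v where v: "v \<in> set p" "A = ?C v"
        using AB(1) unfolding img by (rule imageE)
      obtain w where w: "w \<in> set p" "B = ?C w"
        using AB(2) unfolding img by (rule imageE)
      have "first_occ p v = first_occ p w"
        using AB(3) v w by (simp add: first_occ_def)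
      then have "v = w" using inj v(1) w(1) by (metis inj_onD)
      then show "A = B" using v w by simp
    qed
    have "sorted_wrt (\<lambda>v w. first_occ p v \<le> first_occ p w) (occ_order p)"
      using sorted_first_occ by (rule sorted_wrt_mono_rel[rotated]) simp
    then show "sorted (map Min (map ?C (occ_order p)))"
      unfolding map_map Min_C sorted_wrt_map .
  qed
qed

text \<open>Blocks of different numbers are disjoint and those occurring here are nonempty, so
  comparing blocks amounts to comparing their numbers.\<close>

lemma rho_deranged_iff:
  assumes "p \<in> Cay n"
  shows "rho p \<in> deranged_OSP n \<longleftrightarrow> p \<in> DCP n"
proof -
  obtain k where k: "set p = {1..k}" using assms by (auto simp: Cay_def)
  let ?C = "\<lambda>v. {i \<in> {1..length p}. p ! (i - 1) = v}"
  have "rho p ! j = sort_key Min (rho p) ! j \<longleftrightarrow> Suc j = occ_order p ! j" if j: "j < k" for j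
  proof -
    have "Suc j \<in> set p" using j k by auto
    then obtain i where i: "i \<in> ?C (Suc j)" using rho_nonempty[of "Suc j" p] by auto
    have "?C (Suc j) = ?C v \<longleftrightarrow> Suc j = v" for v
    proof
      assume "?C (Suc j) = ?C v"
      then have "i \<in> ?C v" using i by simp
      then show "Suc j = v" using i by simp
    qed simp
    then show ?thesis using j k by (simp add: nth_rho sort_key_rho[OF assms])
  qed
  then show ?thesis
    using assms k rho_OSP[OF assms]
    by (auto simp: deranged_OSP_def DCP_iff deranged_list_def)
qed

section \<open>Outcomes of unit interval parking functions\<close>

text \<open>Eliminates \<open>Min\<close> from the parking rule, so that a proposed spot can be
  checked directly.\<close>

lemma first_free_iff:
  "{a..n} - occ \<noteq> {} \<and> s = Min ({a..n} - occ) \<longleftrightarrow>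
    a \<le> s \<and> s \<le> n \<and> s \<notin> occ \<and> {a..<s} \<subseteq> occ" for s :: nat
proof
  assume *: "{a..n} - occ \<noteq> {} \<and> s = Min ({a..n} - occ)"
  then have "s \<in> {a..n} - occ" by (metis Min_in finite_Diff finite_atLeastAtMost)
  moreover have "t \<in> occ" if "t \<in> {a..<s}" for t
  proof (rule ccontr)
    assume "t \<notin> occ"
    then have "t \<in> {a..n} - occ" using that \<open>s \<in> _\<close> by auto
    then have "s \<le> t" using * by simp
    then show False using that by simp
  qed
  ultimately show "a \<le> s \<and> s \<le> n \<and> s \<notin> occ \<and> {a..<s} \<subseteq> occ" by auto
next
  assume *: "a \<le> s \<and> s \<le> n \<and> s \<notin> occ \<and> {a..<s} \<subseteq> occ"
  have "Min ({a..n} - occ) = s"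
  proof (rule Min_eqI)
    fix t assume "t \<in> {a..n} - occ"
    then show "s \<le> t" using * by (meson DiffD1 DiffD2 atLeastAtMost_iff atLeastLessThan_iff in_mono not_le)
  qed (use * in auto)
  then show "{a..n} - occ \<noteq> {} \<and> s = Min ({a..n} - occ)" using * by auto
qed

text \<open>Turns the recursion into a condition on each car separately: when car \<open>i\<close>
  arrives, the occupied spots are \<open>occ\<close> and those in \<open>take i ss\<close>.\<close>

lemma park_Some_iff:
  "park n occ as = Some ss \<longleftrightarrow> length ss = length as \<and>
    (\<forall>i<length as. as ! i \<le> ss ! i \<and> ss ! i \<le> n \<and> ss ! i \<notin> occ \<union> set (take i ss) \<and>
      {as ! i..<ss ! i} \<subseteq> occ \<union> set (take i ss))"
proof (induction as arbitrary: occ ss)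
  case Nil
  then show ?case by auto
next
  case (Cons a as)
  show ?case
  proof (cases ss)
    case Nil
    then show ?thesis by (auto simp: Let_def)
  next
    case ss: (Cons s ss')
    have "park n occ (a # as) = Some ss \<longleftrightarrow>
        ({a..n} - occ \<noteq> {} \<and> s = Min ({a..n} - occ)) \<and> park n (insert s occ) as = Some ss'"
      by (auto simp: Let_def ss)
    then show ?thesis
      unfolding first_free_iff Cons.IH ss by (auto simp: All_less_Suc2)
  qed
qed

text \<open>A certificate for membership in \<open>UPF\<close>: \<open>ss\<close> lists the spots
  taken, and an unlucky car is displaced by one because an earlier car holds its preferred
  spot.\<close>

definition unit_outcome :: "nat list \<Rightarrow> nat list \<Rightarrow> bool" where
  "unit_outcome \<alpha> ss \<longleftrightarrow> length ss = length \<alpha> \<and> distinct ss \<and>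
    set ss = {1..length \<alpha>} \<and> set \<alpha> \<subseteq> {1..length \<alpha>} \<and>
    (\<forall>i<length \<alpha>. \<alpha> ! i = ss ! i \<or> (Suc (\<alpha> ! i) = ss ! i \<and> \<alpha> ! i \<in> set (take i ss)))"

lemma UPF_iff: "\<alpha> \<in> UPF n \<longleftrightarrow> length \<alpha> = n \<and> (\<exists>ss. unit_outcome \<alpha> ss)"
proof
  assume \<alpha>: "\<alpha> \<in> UPF n"
  then have len: "length \<alpha> = n" and set: "set \<alpha> \<subseteq> {1..n}"
    by (auto simp: UPF_def parking_functions_def)
  obtain ss where ss: "park n {} \<alpha> = Some ss"
    using \<alpha> by (auto simp: UPF_def parking_functions_def)
  have unit: "int (ss ! i) - int (\<alpha> ! i) \<in> {0, 1}" if "i < n" for i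
  proof -
    have "Suc i \<in> {1..n}" using that by simp
    then have "int (the (park n {} \<alpha>) ! (Suc i - 1)) - int (\<alpha> ! (Suc i - 1)) \<in> {0, 1}"
      using \<alpha> unfolding UPF_def by blast
    then show ?thesis using ss by simp
  qed
  have len_ss: "length ss = n"
    and spot: "\<And>i. i < n \<Longrightarrow> \<alpha> ! i \<le> ss ! i \<and> ss ! i \<le> n \<and> ss ! i \<notin> set (take i ss) \<and>
      {\<alpha> ! i..<ss ! i} \<subseteq> set (take i ss)"
    using ss len by (auto simp: park_Some_iff)
  have "ss ! i \<noteq> ss ! j" if "i < j" "j < n" for i j
    using spot[OF that(2)] that len_ss by (auto simp: in_set_conv_nth)
  then have distinct: "distinct ss"
    using len_ss by (metis distinct_conv_nth linorder_neqE_nat)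
  have "ss ! i \<in> {1..n}" if "i < n" for i
  proof -
    have "\<alpha> ! i \<in> {1..n}" using set that len nth_mem by blast
    then show ?thesis using spot[OF that] by auto
  qed
  then have "set ss \<subseteq> {1..n}"
    using len_ss by (metis in_set_conv_nth subsetI)
  \<comment> \<open>There are \<open>n\<close> distinct spots within \<open>{1..n}\<close>, so all
    are taken.\<close>
  then have "set ss = {1..n}"
    using distinct len_ss by (intro card_subset_eq) (auto simp: distinct_card)
  moreover have "\<alpha> ! i = ss ! i \<or> (Suc (\<alpha> ! i) = ss ! i \<and> \<alpha> ! i \<in> set (take i ss))"
    if "i < n" for i
    using unit[OF that] spot[OF that] by auto
  ultimately show "length \<alpha> = n \<and> (\<exists>ss. unit_outcome \<alpha> ss)"
    using len len_ss distinct set by (auto simp: unit_outcome_def)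
next
  assume "length \<alpha> = n \<and> (\<exists>ss. unit_outcome \<alpha> ss)"
  then obtain ss where len: "length \<alpha> = n" and ss: "length ss = n" "distinct ss"
      "set ss = {1..n}" "set \<alpha> \<subseteq> {1..n}"
      and unit: "\<And>i. i < n \<Longrightarrow> \<alpha> ! i = ss ! i \<or> (Suc (\<alpha> ! i) = ss ! i \<and> \<alpha> ! i \<in> set (take i ss))"
    by (auto simp: unit_outcome_def)
  have "park n {} \<alpha> = Some ss"
    unfolding park_Some_iff
  proof (intro conjI allI impI)
    fix i assume i: "i < length \<alpha>"
    then have "ss ! i \<in> set ss" using len ss(1) by simp
    then show "ss ! i \<le> n" using ss by simp
    show "\<alpha> ! i \<le> ss ! i" using unit[of i] i len by auto
    show "ss ! i \<notin> {} \<union> set (take i ss)"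
      using ss i len by (auto simp: in_set_conv_nth nth_eq_iff_index_eq)
    \<comment> \<open>This interval is empty for a lucky car and consists of the preferred spot
      alone otherwise.\<close>
    show "{\<alpha> ! i..<ss ! i} \<subseteq> {} \<union> set (take i ss)"
      using unit[of i] i len by (auto simp: le_less_Suc_eq less_Suc_eq_le dest!: sym[of _ "ss ! i"])
  qed (use len ss in simp)
  moreover have "int (ss ! (i - 1)) - int (\<alpha> ! (i - 1)) \<in> {0, 1}" if "i \<in> {1..n}" for i
    using unit[of "i - 1"] that by auto
  ultimately show "\<alpha> \<in> UPF n"
    using len ss by (simp add: UPF_def parking_functions_def)
qed

text \<open>
  A car that prefers spot \<open>t\<close> parks in \<open>t\<close> or \<open>t + 1\<close>, so preferences increase weakly along the
  street.
\<close>

lemma nth_sort_outcome: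
  assumes "unit_outcome \<alpha> ss" "i < length \<alpha>"
  shows "sort \<alpha> ! (ss ! i - 1) = \<alpha> ! i"
proof -
  let ?n = "length \<alpha>"
  have ss: "length ss = ?n" "distinct ss" "set ss = {1..?n}"
    and unit: "\<And>i. i < ?n \<Longrightarrow> \<alpha> ! i = ss ! i \<or> Suc (\<alpha> ! i) = ss ! i"
    using assms(1) by (auto simp: unit_outcome_def)
  \<comment> \<open>\<open>car t\<close> is the list position of the car parked in spot
    \<open>t\<close>; \<open>?b\<close> below lists the preferences in the order of the
    spots.\<close>
  define car where "car = inv_into {..<?n} ((!) ss)"
  have bij: "bij_betw ((!) ss) {..<?n} {1..?n}"
    using ss bij_betw_nth[of ss "{..<?n}" "{1..?n}"] by simp
  have bij_car: "bij_betw car {1..?n} {..<?n}"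
    unfolding car_def by (rule bij_betw_inv_into[OF bij])
  have car_ss: "car (ss ! j) = j" if "j < ?n" for j
    unfolding car_def using bij that by (simp add: bij_betw_def)
  have ss_car: "car t < ?n" "ss ! car t = t" if "t \<in> {1..?n}" for t
    using bij_betwE[OF bij_car] bij_betw_inv_into_right[OF bij, of t] that by (auto simp: car_def)
  let ?b = "map (\<lambda>t. \<alpha> ! car t) [1..<Suc ?n]"
  have "mset (map car [1..<Suc ?n]) = mset [0..<?n]"
    using bij_car
    by (subst set_eq_iff_mset_eq_distinct[symmetric])
      (auto simp: distinct_map bij_betw_def atLeastLessThanSuc_atLeastAtMost lessThan_atLeast0
        simp del: upt_Suc)
  then have "image_mset ((!) \<alpha>) (mset (map car [1..<Suc ?n])) = image_mset ((!) \<alpha>) (mset [0..<?n])"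
    by (rule arg_cong)
  then have "mset ?b = mset (map ((!) \<alpha>) [0..<?n])"
    by (simp only: mset_map multiset.map_comp comp_def)
  then have "mset ?b = mset \<alpha>" by (simp only: map_nth)
  moreover have "sorted ?b"
  proof -
    \<comment> \<open>The left preference is at most \<open>s\<close>, the right one at least
      \<open>t - 1\<close>, hence at least \<open>s\<close>.\<close>
    have "\<alpha> ! car s \<le> \<alpha> ! car t" if "1 \<le> s" "s < t" "t \<le> ?n" for s t
      using unit[of "car s"] unit[of "car t"] ss_car[of s] ss_car[of t] that by auto
    then show ?thesis
      by (auto simp: sorted_iff_nth_mono_less simp del: upt_Suc)
  qed
  ultimately have sort: "sort \<alpha> = ?b" by (rule properties_for_sort)
  have "ss ! i \<in> {1..?n}" using assms(2) ss nth_mem[of i ss] by simp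
  then have "?b ! (ss ! i - 1) = \<alpha> ! car (ss ! i)"
    by (subst nth_map) (auto simp del: upt_Suc)
  then show ?thesis
    unfolding sort using car_ss[OF assms(2)] by simp
qed

text \<open>Entry \<open>t\<close> of the sorted tuple is the preference of the car in spot
  \<open>t\<close>, so blocks start exactly at the spots of lucky cars.\<close>

lemma block_starts_outcome:
  assumes "unit_outcome \<alpha> ss"
  shows "block_starts \<alpha> = sorted_list_of_set {ss ! i |i. i < length \<alpha> \<and> \<alpha> ! i = ss ! i}"
proof -
  have ss: "length ss = length \<alpha>" "set ss = {1..length \<alpha>}"
    using assms by (auto simp: unit_outcome_def)
  have "{t \<in> {1..length \<alpha>}. sort \<alpha> ! (t - 1) = t} =
      {ss ! i |i. i < length \<alpha> \<and> \<alpha> ! i = ss ! i}"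
  proof (intro equalityI subsetI)
    fix t assume t: "t \<in> {t \<in> {1..length \<alpha>}. sort \<alpha> ! (t - 1) = t}"
    then have "t \<in> set ss" using ss by simp
    then obtain i where "i < length \<alpha>" "t = ss ! i" using ss(1) by (metis in_set_conv_nth)
    then show "t \<in> {ss ! i |i. i < length \<alpha> \<and> \<alpha> ! i = ss ! i}"
      using t nth_sort_outcome[OF assms] by auto
  next
    fix t assume "t \<in> {ss ! i |i. i < length \<alpha> \<and> \<alpha> ! i = ss ! i}"
    then obtain i where i: "i < length \<alpha>" "\<alpha> ! i = ss ! i" "t = ss ! i" by auto
    then have "t \<in> set ss" using ss(1) by simp
    then show "t \<in> {t \<in> {1..length \<alpha>}. sort \<alpha> ! (t - 1) = t}"
      using i ss nth_sort_outcome[OF assms i(1)] by simp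
  qed
  then show ?thesis by (simp add: block_starts_def)
qed

lemma card_less_witness:
  assumes "finite B" "A \<subseteq> B" "x \<in> B" "x \<notin> A"
  shows "card A < card B"
  using assms by (metis psubsetI psubset_card_mono)

section \<open>From Cayley permutations to unit interval parking functions\<close>

text \<open>
  The cars of block \<open>v\<close> fill consecutive spots in increasing order, after the cars of the blocks
  \<open>1, \<dots>, v - 1\<close>; only the first car of a block gets its preferred spot.
\<close>

definition spot :: "nat list \<Rightarrow> nat \<Rightarrow> nat" where
  "spot p i = card {j. j < length p \<and> (p ! j < p ! i \<or> (p ! j = p ! i \<and> j \<le> i))}"

definition psi :: "nat list \<Rightarrow> nat list" where
  "psi p = map (\<lambda>i. if p ! i \<in> set (take i p) then spot p i - 1 else spot p i) [0..<length p]"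

lemma length_psi [simp]: "length (psi p) = length p"
  by (simp add: psi_def)

lemma in_set_take_conv: "x \<in> set (take i p) \<longleftrightarrow> (\<exists>j<i. j < length p \<and> p ! j = x)"
  by (auto simp: in_set_conv_nth)

lemma spot_less:
  assumes "j < length p" "p ! i < p ! j \<or> (p ! i = p ! j \<and> i < j)"
  shows "spot p i < spot p j"
  unfolding spot_def by (rule card_less_witness[of _ _ j]) (use assms in auto)

lemma inj_on_spot: "inj_on (spot p) {..<length p}"
proof (rule inj_onI)
  fix i j assume "i \<in> {..<length p}" "j \<in> {..<length p}" "spot p i = spot p j"
  then show "i = j"
    using spot_less[of i p j] spot_less[of j p i]
    by (cases i j rule: linorder_cases; cases "p ! i" "p ! j" rule: linorder_cases) auto
qed

lemma spot_in:
  assumes "i < length p"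
  shows "spot p i \<in> {1..length p}"
proof -
  let ?A = "{j. j < length p \<and> (p ! j < p ! i \<or> (p ! j = p ! i \<and> j \<le> i))}"
  have "card {i} \<le> card ?A" using assms by (intro card_mono) auto
  moreover have "card ?A \<le> card {..<length p}" by (intro card_mono) auto
  ultimately show ?thesis by (simp add: spot_def)
qed

lemma spot_image: "spot p ` {..<length p} = {1..length p}"
proof (rule card_subset_eq)
  show "card (spot p ` {..<length p}) = card {1..length p}"
    by (simp add: card_image inj_on_spot)
qed (use spot_in in auto)

text \<open>Take for \<open>j\<close> the last earlier car with the same value: nothing lies between
  the two in the lexicographic order, so their ranks are consecutive.\<close>

lemma spot_repeated:
  assumes "i < length p" "p ! i \<in> set (take i p)"
  obtains j where "j < i" "p ! j = p ! i" "Suc (spot p j) = spot p i"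
proof -
  let ?J = "{j. j < i \<and> p ! j = p ! i}"
  define j where "j = Max ?J"
  have fin: "finite ?J" by simp
  have "?J \<noteq> {}" using assms by (auto simp: in_set_take_conv)
  then have j: "j < i" "p ! j = p ! i" using Max_in[OF fin] unfolding j_def by auto
  have max: "l \<le> j" if "l < i" "p ! l = p ! i" for l
    unfolding j_def using that by (intro Max_ge[OF fin]) auto
  have "{l. l < length p \<and> (p ! l < p ! i \<or> (p ! l = p ! i \<and> l \<le> i))} =
      insert i {l. l < length p \<and> (p ! l < p ! j \<or> (p ! l = p ! j \<and> l \<le> j))}"
    using j max assms(1) by (auto simp: le_less)
  then have "spot p i = Suc (spot p j)"
    unfolding spot_def using j by simp
  then show ?thesis using j that by simp
qed

text \<open>A car with a repeated value prefers the spot of the preceding car of its block, which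
  has already parked there.\<close>

lemma unit_outcome_psi: "unit_outcome (psi p) (map (spot p) [0..<length p])"
proof -
  have "psi p ! i = spot p i \<or> Suc (psi p ! i) = spot p i \<and> psi p ! i \<in> spot p ` {..<i}"
    "psi p ! i \<in> {1..length p}" if i: "i < length p" for i
  proof -
    have "psi p ! i = spot p i \<or> (\<exists>j<i. Suc (psi p ! i) = spot p i \<and> psi p ! i = spot p j)"
    proof (cases "p ! i \<in> set (take i p)")
      case True
      then obtain j where "j < i" "Suc (spot p j) = spot p i"
        using spot_repeated i by metis
      then show ?thesis using i by (auto simp: psi_def)
    qed (use i in \<open>auto simp: psi_def\<close>)
    then consider "psi p ! i = spot p i"
      | j where "j < i" "Suc (psi p ! i) = spot p i" "psi p ! i = spot p j" by blast
    note cases = this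
    show "psi p ! i = spot p i \<or> Suc (psi p ! i) = spot p i \<and> psi p ! i \<in> spot p ` {..<i}"
      by (cases rule: cases) auto
    show "psi p ! i \<in> {1..length p}"
      using spot_in i by (cases rule: cases) (metis, metis less_trans)
  qed
  moreover from this(2) have "set (psi p) \<subseteq> {1..length p}"
    by (auto simp: in_set_conv_nth)
  ultimately show ?thesis
    using inj_on_spot spot_image
    by (auto simp: unit_outcome_def distinct_map atLeast0LessThan take_map)
qed

section \<open>The block structure of \<open>psi p\<close>\<close>

definition num_below :: "nat list \<Rightarrow> nat \<Rightarrow> nat" where
  "num_below p v = card {j. j < length p \<and> p ! j < v}"

lemma num_below_mono: "v \<le> w \<Longrightarrow> num_below p v \<le> num_below p w"
  unfolding num_below_def by (intro card_mono) auto

lemma num_below_strict_mono: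
  assumes "v < w" "v \<in> set p"
  shows "num_below p v < num_below p w"
proof -
  obtain i where "i < length p" "p ! i = v" using assms(2) by (auto simp: in_set_conv_nth)
  then show ?thesis
    unfolding num_below_def using assms(1) by (intro card_less_witness[of _ _ i]) auto
qed

text \<open>The blocks before \<open>v\<close> hold \<open>num_below p v\<close> cars, so block
  \<open>v\<close> is confined to the spots after \<open>num_below p v\<close> up to
  \<open>num_below p (Suc v)\<close>.\<close>

lemma spot_between:
  assumes "i < length p"
  shows "num_below p (p ! i) < spot p i" "spot p i \<le> num_below p (Suc (p ! i))"
proof -
  show "num_below p (p ! i) < spot p i"
    unfolding num_below_def spot_def by (rule card_less_witness[of _ _ i]) (use assms in auto)
  show "spot p i \<le> num_below p (Suc (p ! i))"
    unfolding num_below_def spot_def by (rule card_mono) auto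
qed

text \<open>Every preference is the spot of some car of the same block: its own, or that of the
  preceding car. So preferences obey the same bounds as spots.\<close>

lemma psi_between:
  assumes "i < length p"
  shows "num_below p (p ! i) < psi p ! i" "psi p ! i \<le> num_below p (Suc (p ! i))"
proof -
  have "\<exists>j<length p. p ! j = p ! i \<and> psi p ! i = spot p j"
  proof (cases "p ! i \<in> set (take i p)")
    case True
    then obtain j where "j < i" "p ! j = p ! i" "Suc (spot p j) = spot p i"
      using spot_repeated assms by metis
    then show ?thesis using assms True by (intro exI[of _ j]) (simp add: psi_def)
  qed (use assms in \<open>auto simp: psi_def\<close>)
  then show "num_below p (p ! i) < psi p ! i" "psi p ! i \<le> num_below p (Suc (p ! i))"
    using spot_between by metis+
qed

lemma spot_first:
  assumes "i < length p" "p ! i \<notin> set (take i p)"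
  shows "spot p i = Suc (num_below p (p ! i))"
proof -
  have "{j. j < length p \<and> (p ! j < p ! i \<or> (p ! j = p ! i \<and> j \<le> i))} =
      insert i {j. j < length p \<and> p ! j < p ! i}"
    using assms by (auto simp: in_set_take_conv le_less)
  then show ?thesis by (simp add: spot_def num_below_def)
qed

text \<open>The lucky cars are the first ones of their blocks, and each takes the first spot of its
  block's interval.\<close>

lemma block_starts_psi:
  assumes "set p = {1..k}"
  shows "block_starts (psi p) = map (\<lambda>v. Suc (num_below p v)) [1..<Suc k]"
proof -
  let ?l = "map (\<lambda>v. Suc (num_below p v)) [1..<Suc k]"
  \<comment> \<open>Spots are at least 1, so the truncated \<open>spot p i - 1\<close> really
    differs from \<open>spot p i\<close>.\<close>
  have lucky: "psi p ! i = spot p i \<longleftrightarrow> p ! i \<notin> set (take i p)" if "i < length p" for i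
    using that spot_in[OF that] by (auto simp: psi_def)
  have "{spot p i |i. i < length p \<and> psi p ! i = spot p i} = set ?l"
  proof (intro equalityI subsetI)
    fix t assume "t \<in> {spot p i |i. i < length p \<and> psi p ! i = spot p i}"
    then obtain i where i: "i < length p" "p ! i \<notin> set (take i p)" "t = spot p i"
      using lucky by auto
    then have "p ! i \<in> {1..k}" using assms nth_mem by blast
    then show "t \<in> set ?l" using spot_first[OF i(1,2)] i(3) by (auto simp del: upt_Suc)
  next
    fix t assume "t \<in> set ?l"
    then obtain v where v: "v \<in> set p" "t = Suc (num_below p v)"
      unfolding set_map set_upt assms atLeastLessThanSuc_atLeastAtMost by blast
    let ?P = "\<lambda>i. i < length p \<and> p ! i = v"
    define i where "i = (LEAST i. ?P i)"
    have "\<exists>i. ?P i" using v(1) by (auto simp: in_set_conv_nth)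
    then have i: "i < length p" "p ! i = v" unfolding i_def using LeastI_ex[of ?P] by auto
    have "p ! j \<noteq> v" if "j < i" for j
      using not_less_Least[of j ?P] that i by (auto simp: i_def)
    then have "p ! i \<notin> set (take i p)" using i by (auto simp: in_set_take_conv)
    then have "t = spot p i" "psi p ! i = spot p i"
      using i v spot_first[of i p] lucky[of i] by auto
    then show "t \<in> {spot p i |i. i < length p \<and> psi p ! i = spot p i}"
      using i(1) by blast
  qed
  moreover have "{map (spot p) [0..<length p] ! i |i. i < length (psi p) \<and>
      psi p ! i = map (spot p) [0..<length p] ! i} =
      {spot p i |i. i < length p \<and> psi p ! i = spot p i}"
    by (intro Collect_cong ex_cong1) auto
  moreover have "sorted_wrt (<) ?l"
    using num_below_strict_mono[of _ _ p] assms
    by (auto simp: sorted_wrt_iff_nth_less simp del: upt_Suc)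
  ultimately show ?thesis
    unfolding block_starts_outcome[OF unit_outcome_psi]
    by (simp only:) (intro sorted_list_of_set.idem_if_sorted_distinct; simp add: strict_sorted_iff del: upt_Suc)
qed

lemma phi_psi:
  assumes "p \<in> Cay n"
  shows "phi (psi p) = rho p"
proof -
  obtain k where k: "set p = {1..k}" "length p = n" using assms by (auto simp: Cay_def)
  let ?N = "\<lambda>v. Suc (num_below p v)"
  have "p ! j < Suc k" if "j < length p" for j
    using k nth_mem[OF that] by auto
  \<comment> \<open>All \<open>n\<close> entries lie below \<open>Suc k\<close>, so the end marker
    \<open>n + 1\<close> fits the formula for block starts as that of a fictitious block
    \<open>k + 1\<close>.\<close>
  then have "num_below p (Suc k) = card {j. j < n}"
    unfolding num_below_def using k by (intro arg_cong[of _ _ card]) auto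
  then have \<nu>: "block_starts (psi p) @ [length (psi p) + 1] = map ?N [1..<Suc (Suc k)]"
    using block_starts_psi[OF k(1)] k by simp
  have len: "length (block_starts (psi p)) = k"
    using block_starts_psi[OF k(1)] by (simp del: upt_Suc)
  show ?thesis
  proof (rule nth_equalityI)
    show "length (phi (psi p)) = length (rho p)"
      using k len by (simp add: phi_def Let_def)
    fix j assume "j < length (phi (psi p))"
    then have j: "j < k" by (simp add: phi_def Let_def len)
    \<comment> \<open>By monotonicity of \<open>num_below\<close>, the bounds from
      \<open>psi_between\<close> exclude a smaller or larger block number.\<close>
    have iff: "?N (Suc j) \<le> psi p ! i \<and> psi p ! i < ?N (Suc (Suc j)) \<longleftrightarrow> p ! i = Suc j"
      if "i < n" for i
      using psi_between[of i p] that k num_below_mono[of "Suc (p ! i)" "Suc j" p]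
        num_below_mono[of "Suc (Suc j)" "p ! i" p]
      by (cases "p ! i" "Suc j" rule: linorder_cases) auto
    have "phi (psi p) ! j = {i \<in> {1..n}. ?N (Suc j) \<le> psi p ! (i - 1) \<and>
        psi p ! (i - 1) < ?N (Suc (Suc j))}"
      using j k unfolding phi_def Let_def \<nu> len by (simp del: upt_Suc)
    also have "\<dots> = {i \<in> {1..n}. p ! (i - 1) = Suc j}"
      by (intro Collect_cong conj_cong refl iff) auto
    also have "\<dots> = rho p ! j" using j k by (simp add: nth_rho)
    finally show "phi (psi p) ! j = rho p ! j" .
  qed
qed

section \<open>Every unit interval parking function arises\<close>

text \<open>A discrete intermediate value principle, used to show that block numbers leave no
  gaps.\<close>

lemma image_unit_steps:
  fixes f :: "nat \<Rightarrow> nat"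
  assumes "f 0 = 0" "\<And>t. f (Suc t) \<in> {f t, Suc (f t)}"
  shows "f ` {0..n} = {0..f n}"
proof (induction n)
  case (Suc n)
  have "f ` {0..Suc n} = insert (f (Suc n)) {0..f n}"
    by (simp add: atLeast0_atMost_Suc Suc)
  then show ?case using assms(2)[of n] by auto
qed (simp add: assms(1))

text \<open>Each car gets its block number as value. Since cars increase within a block, the
  lexicographic order of the pairs of value and position is the order of the spots, so
  \<open>spot\<close> recovers the outcome; the unlucky cars are those with a repeated
  value.\<close>

lemma UPF_eq_psi:
  assumes "\<alpha> \<in> UPF n"
  obtains p where "p \<in> Cay n" "psi p = \<alpha>"
proof -
  obtain ss where outcome: "unit_outcome \<alpha> ss" and len_\<alpha>: "length \<alpha> = n"
    using assms by (auto simp: UPF_iff)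
  then have ss: "length ss = n" "distinct ss" "set ss = {1..n}" "set \<alpha> \<subseteq> {1..n}"
    and unit: "\<And>i. i < n \<Longrightarrow> \<alpha> ! i = ss ! i \<or> (Suc (\<alpha> ! i) = ss ! i \<and> \<alpha> ! i \<in> set (take i ss))"
    by (auto simp: unit_outcome_def)
  have inj: "i = j" if "ss ! i = ss ! j" "i < n" "j < n" for i j
    using that ss by (simp add: nth_eq_iff_index_eq)
  have ss_in: "ss ! i \<in> {1..n}" if "i < n" for i
    using that ss nth_mem by metis
  have car: "\<exists>i<n. ss ! i = t" if "t \<in> {1..n}" for t
    using that ss by (metis in_set_conv_nth)
  define lucky where "lucky = {ss ! i |i. i < n \<and> \<alpha> ! i = ss ! i}"
  \<comment> \<open>Each lucky car opens a block, so \<open>f t\<close> is the number of the block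
    containing spot \<open>t\<close>.\<close>
  define f where "f t = card (lucky \<inter> {..t})" for t
  define p where "p = map f ss"
  have lucky_iff: "ss ! i \<in> lucky \<longleftrightarrow> \<alpha> ! i = ss ! i" if "i < n" for i
    using that inj by (auto simp: lucky_def)
  have lucky_sub: "lucky \<subseteq> {1..n}" using ss_in by (auto simp: lucky_def)
  have f_mono: "f s \<le> f t" if "s \<le> t" for s t
    unfolding f_def using that by (intro card_mono) auto
  have f_lucky: "f s < f t" if "s < t" "t \<in> lucky" for s t
    unfolding f_def using that by (intro card_less_witness[of _ _ t]) auto
  have f_Suc: "f (Suc t) = (if Suc t \<in> lucky then Suc (f t) else f t)" for t
    unfolding f_def by (simp add: atMost_Suc)
  have f0: "f 0 = 0" using lucky_sub by (auto simp: f_def)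
  \<comment> \<open>The car in spot 1 is lucky, as an unlucky one would prefer spot 0.\<close>
  have f_pos: "f t > 0" if t: "t \<in> {1..n}" for t
  proof -
    obtain i where i: "i < n" "ss ! i = 1" using car[of 1] t by auto
    moreover have "\<alpha> ! i \<in> {1..n}" using ss(4) i len_\<alpha> nth_mem by blast
    ultimately have "1 \<in> lucky" using unit[OF i(1)] lucky_iff[OF i(1)] by auto
    then have "f 0 < f 1" by (intro f_lucky) auto
    then show ?thesis using f_mono[of 1 t] that by auto
  qed
  have len: "length p = n" using ss(1) by (simp add: p_def)
  have nth_p: "p ! i = f (ss ! i)" if "i < n" for i
    using that ss(1) by (simp add: p_def)
  have "set p = f ` set ss" by (simp add: p_def)
  also have "\<dots> = {1..f n}"
  proof -
    have img: "f ` {0..n} = {0..f n}"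
      by (rule image_unit_steps) (auto simp: f0 f_Suc)
    have "f ` {1..n} = {0..f n} - {0}"
    proof (intro equalityI subsetI)
      fix x assume x: "x \<in> {0..f n} - {0}"
      then obtain t where "t \<in> {0..n}" "x = f t" using img by (metis DiffD1 imageE)
      moreover from this have "t \<noteq> 0" using f0 x by (intro notI) simp
      ultimately show "x \<in> f ` {1..n}" by auto
    qed (use f_pos f_mono in force)
    then show ?thesis using ss by auto
  qed
  finally have Cay: "p \<in> Cay n" using len by (auto simp: Cay_def)

  \<comment> \<open>Induction over the spots to the right of \<open>ss ! i\<close> in the same
    block: none of them is lucky, so the car in each came after the car in the spot just
    before.\<close>
  have increasing: "i < j"
    if "i < n" "j < n" "ss ! i < ss ! j" "f (ss ! i) = f (ss ! j)" for i j
  proof -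
    have "\<forall>j<n. ss ! j = t \<longrightarrow> f (ss ! i) = f t \<longrightarrow> i < j" if "Suc (ss ! i) \<le> t" for t
      using that
    proof (induction t rule: dec_induct)
      case base
      show ?case
      proof (intro allI impI)
        fix j assume j: "j < n" "ss ! j = Suc (ss ! i)" "f (ss ! i) = f (Suc (ss ! i))"
        then have "ss ! j \<notin> lucky" using f_lucky[of "ss ! i" "ss ! j"] by auto
        then have "ss ! i \<in> set (take j ss)" using unit[OF j(1)] lucky_iff[OF j(1)] j by auto
        then show "i < j" using inj j ss \<open>i < n\<close> by (auto simp: in_set_take_conv)
      qed
    next
      case (step t)
      show ?case
      proof (intro allI impI)
        fix j assume j: "j < n" "ss ! j = Suc t" "f (ss ! i) = f (Suc t)"
        \<comment> \<open>The monotone \<open>f\<close> agrees at \<open>ss ! i\<close> and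
          \<open>Suc t\<close>, so it is constant in between.\<close>
        have eq: "f (ss ! i) = f t"
          using f_mono[of "ss ! i" t] f_mono[of t "Suc t"] step j by simp
        then have "ss ! j \<notin> lucky" using f_lucky[of t "ss ! j"] j by auto
        then have "t \<in> set (take j ss)" using unit[OF j(1)] lucky_iff[OF j(1)] j by auto
        then obtain l where "l < j" "l < n" "ss ! l = t" using ss by (auto simp: in_set_take_conv)
        then show "i < j" using step eq by auto
      qed
    qed
    from this[of "ss ! j"] show ?thesis using that by simp
  qed
  have less: "ss ! i < ss ! j" if ij: "i < n" "j < n" "p ! i < p ! j \<or> (p ! i = p ! j \<and> i < j)" for i j
  proof (rule ccontr)
    assume "\<not> ss ! i < ss ! j"
    then consider "ss ! j < ss ! i" | "i = j" using inj ij(1,2) by (meson linorder_neqE_nat)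
    then show False
    proof cases
      case 1
      then show False
        using that increasing[of j i] f_mono[of "ss ! j" "ss ! i"] nth_p by auto
    qed (use ij in auto)
  qed
  have order: "(p ! j < p ! i \<or> (p ! j = p ! i \<and> j \<le> i)) \<longleftrightarrow> ss ! j \<le> ss ! i"
    if "i < n" "j < n" for i j
    using less[of i j] less[of j i] that
    by (cases i j rule: linorder_cases; cases "p ! i" "p ! j" rule: linorder_cases) auto
  have spot: "spot p i = ss ! i" if i: "i < n" for i
  proof -
    have "{j. j < n \<and> (p ! j < p ! i \<or> (p ! j = p ! i \<and> j \<le> i))} = {j. j < n \<and> ss ! j \<le> ss ! i}"
      using order i by blast
    \<comment> \<open>Every spot is filled, so the cars up to spot \<open>ss ! i\<close> number
      exactly \<open>ss ! i\<close>.\<close>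
    moreover have "(!) ss ` {j. j < n \<and> ss ! j \<le> ss ! i} = {1..ss ! i}"
      using ss_in ss_in[OF i] car by (auto simp: image_iff) (metis atLeastAtMost_iff order_trans One_nat_def)
    moreover have "inj_on ((!) ss) {j. j < n \<and> ss ! j \<le> ss ! i}"
      using inj by (auto intro: inj_onI)
    ultimately show ?thesis
      unfolding spot_def len by (metis card_atLeastAtMost card_image diff_Suc_1)
  qed
  have "psi p = \<alpha>"
  proof (rule nth_equalityI)
    fix i assume "i < length (psi p)"
    then have i: "i < n" using len by simp
    \<comment> \<open>An earlier car of the same block parks further left, and a lucky spot would
      have raised \<open>f\<close> in between. Conversely, the spot before an unlucky car holds an
      earlier car of its block.\<close>
    have "p ! i \<in> set (take i p) \<longleftrightarrow> \<alpha> ! i \<noteq> ss ! i"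
    proof
      assume "p ! i \<in> set (take i p)"
      then obtain j where j: "j < i" "p ! j = p ! i" by (auto simp: in_set_take_conv)
      then have "ss ! j < ss ! i" using less[of j i] i by simp
      then have "ss ! i \<notin> lucky" using f_lucky[of "ss ! j" "ss ! i"] nth_p j i by auto
      then show "\<alpha> ! i \<noteq> ss ! i" using lucky_iff[OF i] by simp
    next
      assume ne: "\<alpha> ! i \<noteq> ss ! i"
      then have "Suc (\<alpha> ! i) = ss ! i" "\<alpha> ! i \<in> set (take i ss)" using unit[OF i] by auto
      then obtain j where j: "j < i" "Suc (ss ! j) = ss ! i" using ss by (auto simp: in_set_take_conv)
      have "f (Suc (ss ! j)) = f (ss ! j)"
        using f_Suc[of "ss ! j"] lucky_iff[OF i] ne j by simp
      then have "p ! j = p ! i" using nth_p i j by simp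
      then show "p ! i \<in> set (take i p)" using i j len by (auto simp: in_set_take_conv)
    qed
    then show "psi p ! i = \<alpha> ! i"
      using i len spot[OF i] unit[OF i] by (auto simp: psi_def)
  qed (simp add: len len_\<alpha>)
  then show ?thesis using Cay that by simp
qed

section \<open>\<open>psi\<close> as the inverse of \<open>Theta\<close>\<close>

lemma psi_UPF: "p \<in> Cay n \<Longrightarrow> psi p \<in> UPF n"
  using unit_outcome_psi[of p] by (auto simp: UPF_iff Cay_def)

lemma Theta_psi: "p \<in> Cay n \<Longrightarrow> Theta n (psi p) = p"
  by (simp add: Theta_def phi_psi inj_on_rho inv_into_f_f)

theorem proposition5p9:
  fixes n :: nat
  shows "Theta n \<in> UPF n \<rightarrow> Cay n \<and> bij_betw (Theta n) (DUPF n) (DCP n) \<and>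
    card (DCP n) = deranged_bell n"
proof (intro conjI card_DCP)
  show "Theta n \<in> UPF n \<rightarrow> Cay n"
    using UPF_eq_psi Theta_psi by (metis Pi_I)
  \<comment> \<open>By \<open>UPF_eq_psi\<close> every member of \<open>UPF n\<close> has the form
    \<open>psi p\<close>, so it suffices to compare both notions of being deranged along
    \<open>psi\<close>.\<close>
  have DUPF_psi: "psi p \<in> DUPF n \<longleftrightarrow> p \<in> DCP n" if "p \<in> Cay n" for p
    using that by (simp add: DUPF_def psi_UPF phi_psi rho_deranged_iff)
  have DCP: "p \<in> Cay n" if "p \<in> DCP n" for p using that by (simp add: DCP_def)
  have DUPF: "\<exists>p\<in>DCP n. psi p = \<alpha>" if "\<alpha> \<in> DUPF n" for \<alpha>
    using that UPF_eq_psi[of \<alpha> n] DUPF_psi by (metis (no_types, lifting) DUPF_def mem_Collect_eq)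
  show "bij_betw (Theta n) (DUPF n) (DCP n)"
  proof (rule bij_betw_byWitness[where f' = psi])
    show "\<forall>\<alpha>\<in>DUPF n. psi (Theta n \<alpha>) = \<alpha>" using DUPF DCP Theta_psi by metis
    show "\<forall>p\<in>DCP n. Theta n (psi p) = p" using DCP Theta_psi by blast
    show "Theta n ` DUPF n \<subseteq> DCP n" using DUPF DCP Theta_psi by (metis image_subsetI)
    show "psi ` DCP n \<subseteq> DUPF n" using DUPF_psi DCP by blast
  qed
qed

end
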